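(* Let $N:=m^{[\frac{d+1}{2}]}$. If ${\rm Det}(U)\neq0$ for some $U\in C\ell^{\frac1m}_d$, then $U$ is invertible and we have an explicit formula for the inverse: $$U^{-1}=\frac{C_{(N-1)}-U_{(N-1)}}{{\rm Det}(U)},$$ where $U_{(k)}$ and $C_{(k)}$ are defined recursively by $$U_{(1)}:=U,\qquad C_{(k)}:=\frac{N}{k}\langle U_{(k)}\rangle_0,\qquad U_{(k+1)}:=U(U_{(k)}-C_{(k)}).$$
   Context: The generalized (complex) Clifford algebra $C\ell^{\frac1m}_d$ is the unital associative algebra over $\mathbb{C}$ with identity $e$ and generators $e_1,\dots,e_d$ subject to $e_j^m=e$ for $j=1,\dots,d$ and $e_ke_l=\omega e_le_k$ for $k<l$, where $\omega:=e^{2\pi i/m}$. It has dimension $m^d$ with basis $e_1^{j_1}\cdots e_d^{j_d}$, $0\le j_1,\dots,j_d\le m-1$, so each element is uniquely $U=\sum u_{j_1\ldots j_d}e_1^{j_1}\cdots e_d^{j_d}$ with $u_{j_1\ldots j_d}\in\mathbb{C}$. Scalars $c\in\mathbb{C}$ are identified with $ce$. The projection onto grade $0$ is $\langle U\rangle_0:=u_{0\ldots0}e\equiv u_{0\ldots0}\in\mathbb{C}$. Here $[\cdot]$ denotes the integer part. Determinant: ${\rm Det}(U):=\det(\gamma(U))\in\mathbb{C}$, where $\gamma$ is any faithful matrix representation of minimal dimension, i.e. any isomorphism of unital complex algebras from $C\ell^{\frac1m}_d$ onto ${\rm Mat}(m^{\frac d2},\mathbb{C})$ if $d$ is even, and onto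 the direct sum of $m$ copies of ${\rm Mat}(m^{\frac{d-1}2},\mathbb{C})$, regarded as block-diagonal matrices of size $m^{\frac{d+1}{2}}$, if $d$ is odd. In both cases the matrices have size $N$; ${\rm Det}$ does not depend on the choice of $\gamma$. The scalars $C_{(k)}$, $k=1,\dots,N$, are the characteristic polynomial coefficients of $U$, in the convention ${\rm Det}(\lambda e-U)=\lambda^N-C_{(1)}\lambda^{N-1}-\cdots-C_{(N)}$.
   Formalization: The formula is proved with an extra factor (-1)^N on the right, needed for odd N (for m=3, d=1, U=e the printed one gives -e); for even N it is as printed. It is stated for m ≥ 2 and d ≥ 1, since otherwise N=1 and U_(0), C_(0) are undefined. *)

theory Defs
  imports Complex_Main "HOL-Algebra.QuotRing" "HOL-Library.FuncSet"
    "Jordan_Normal_Form.Determinant"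
begin

hide_const (open) Multiset.mult

section \<open>The free algebra on the letters 1, ..., d\<close>

text \<open>Elements are finitely supported functions from words to the complex numbers; a word is a
  list of letters from \<open>{1..d}\<close>, and the product is convolution along concatenation.\<close>

definition free_alg :: "nat \<Rightarrow> (nat list \<Rightarrow> complex) ring" where
  "free_alg d =
    \<lparr>carrier = {f. finite {w. f w \<noteq> 0} \<and> (\<forall>w. f w \<noteq> 0 \<longrightarrow> set w \<subseteq> {1..d})},
     mult = (\<lambda>f g w. \<Sum>(u, v) \<in> {(u, v). u @ v = w}. f u * g v),
     one = (\<lambda>w. if w = [] then 1 else 0),
     zero = (\<lambda>w. 0),
     add = (\<lambda>f g w. f w + g w)\<rparr>"

definition free_const :: "complex \<Rightarrow> nat list \<Rightarrow> complex" where
  "free_const c = (\<lambda>w. if w = [] then c else 0)"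

definition free_gen :: "nat \<Rightarrow> nat list \<Rightarrow> complex" where
  "free_gen j = (\<lambda>w. if w = [j] then 1 else 0)"

lemma finite_splits: "finite {(u, v). u @ v = w}"
proof (rule finite_subset)
  show "{(u, v). u @ v = w} \<subseteq> (\<lambda>i. (take i w, drop i w)) ` {..length w}"
  proof (clarsimp simp: image_iff)
    fix u v :: "'a list"
    show "\<exists>i\<in>{..length u + length v}.
        u = take i u @ take (i - length u) v \<and> v = drop i u @ drop (i - length u) v"
      by (rule bexI[where x = "length u"]) auto
  qed
qed simp

lemma free_alg_mult_closed:
  assumes f: "f \<in> carrier (free_alg d)" and g: "g \<in> carrier (free_alg d)"
  shows "f \<otimes>\<^bsub>free_alg d\<^esub> g \<in> carrier (free_alg d)"
proof -
  let ?h = "\<lambda>w. \<Sum>(u, v) \<in> {(u, v). u @ v = w}. f u * g v"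
  have split: "\<exists>u v. u @ v = w \<and> f u \<noteq> 0 \<and> g v \<noteq> 0" if "?h w \<noteq> 0" for w
  proof (rule ccontr)
    assume "\<nexists>u v. u @ v = w \<and> f u \<noteq> 0 \<and> g v \<noteq> 0"
    then have "?h w = 0"
      by (intro sum.neutral) auto
    with that show False
      by contradiction
  qed
  have "{w. ?h w \<noteq> 0} \<subseteq> (\<lambda>(u, v). u @ v) ` ({w. f w \<noteq> 0} \<times> {w. g w \<noteq> 0})"
    using split by fastforce
  moreover have "finite ({w. f w \<noteq> 0} \<times> {w. g w \<noteq> 0})"
    using f g by (simp add: free_alg_def)
  ultimately have "finite {w. ?h w \<noteq> 0}"
    by (meson finite_imageI finite_subset)
  moreover have "set w \<subseteq> {1..d}" if "?h w \<noteq> 0" for w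
  proof -
    obtain u v where "u @ v = w" "f u \<noteq> 0" "g v \<noteq> 0"
      using split \<open>?h w \<noteq> 0\<close> by blast
    then show ?thesis
      using f g by (fastforce simp: free_alg_def)
  qed
  ultimately show ?thesis
    by (simp add: free_alg_def)
qed

lemma free_alg_mult_assoc:
  fixes f g h :: "nat list \<Rightarrow> complex"
  shows "f \<otimes>\<^bsub>free_alg d\<^esub> g \<otimes>\<^bsub>free_alg d\<^esub> h = f \<otimes>\<^bsub>free_alg d\<^esub> (g \<otimes>\<^bsub>free_alg d\<^esub> h)"
proof
  fix w :: "nat list"
  let ?S = "\<lambda>w :: nat list. {(u, v). u @ v = w}"
  have "(f \<otimes>\<^bsub>free_alg d\<^esub> g \<otimes>\<^bsub>free_alg d\<^esub> h) w =
      (\<Sum>p \<in> ?S w. \<Sum>q \<in> ?S (fst p). f (fst q) * g (snd q) * h (snd p))"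
    by (simp add: free_alg_def case_prod_beta sum_distrib_right)
  also have "\<dots> = (\<Sum>(p, q) \<in> Sigma (?S w) (\<lambda>p. ?S (fst p)). f (fst q) * g (snd q) * h (snd p))"
    by (rule sum.Sigma) (auto simp: finite_splits)
  also have "\<dots> = (\<Sum>(p, q) \<in> Sigma (?S w) (\<lambda>p. ?S (snd p)). f (fst p) * (g (fst q) * h (snd q)))"
    by (rule sum.reindex_bij_witness[where
          i = "\<lambda>((a, _), (b, c)). ((a @ b, c), (a, b))" and
          j = "\<lambda>((_, c), (a, b)). ((a, b @ c), (b, c))"]) auto
  also have "\<dots> = (\<Sum>p \<in> ?S w. \<Sum>q \<in> ?S (snd p). f (fst p) * (g (fst q) * h (snd q)))"
    by (rule sum.Sigma[symmetric]) (auto simp: finite_splits)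
  also have "\<dots> = (f \<otimes>\<^bsub>free_alg d\<^esub> (g \<otimes>\<^bsub>free_alg d\<^esub> h)) w"
    by (simp add: free_alg_def case_prod_beta sum_distrib_left)
  finally show "(f \<otimes>\<^bsub>free_alg d\<^esub> g \<otimes>\<^bsub>free_alg d\<^esub> h) w =
      (f \<otimes>\<^bsub>free_alg d\<^esub> (g \<otimes>\<^bsub>free_alg d\<^esub> h)) w" .
qed

lemma free_alg_one:
  fixes f :: "nat list \<Rightarrow> complex"
  shows "\<one>\<^bsub>free_alg d\<^esub> \<otimes>\<^bsub>free_alg d\<^esub> f = f" and "f \<otimes>\<^bsub>free_alg d\<^esub> \<one>\<^bsub>free_alg d\<^esub> = f"
proof -
  have "(\<Sum>(u, v) \<in> {(u, v). u @ v = w}. (if u = [] then 1 else 0) * f v) = f w" for w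
  proof -
    have "(\<Sum>(u, v) \<in> {(u, v). u @ v = w}. (if u = [] then 1 else 0) * f v) =
        (\<Sum>(u, v) \<in> {([] :: nat list, w)}. (if u = [] then 1 else 0) * f v)"
      by (rule sum.mono_neutral_right) (auto simp: finite_splits split: if_splits)
    then show ?thesis
      by simp
  qed
  moreover have "(\<Sum>(u, v) \<in> {(u, v). u @ v = w}. f u * (if v = [] then 1 else 0)) = f w" for w
  proof -
    have "(\<Sum>(u, v) \<in> {(u, v). u @ v = w}. f u * (if v = [] then 1 else 0)) =
        (\<Sum>(u, v) \<in> {(w, [] :: nat list)}. f u * (if v = [] then 1 else 0))"
      by (rule sum.mono_neutral_right) (auto simp: finite_splits split: if_splits)
    then show ?thesis
      by simp
  qed
  ultimately show "\<one>\<^bsub>free_alg d\<^esub> \<otimes>\<^bsub>free_alg d\<^esub> f = f" and "f \<otimes>\<^bsub>free_alg d\<^esub> \<one>\<^bsub>free_alg d\<^esub> = f"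
    by (simp_all add: free_alg_def)
qed

lemma free_alg_ring: "ring (free_alg d)"
proof (rule ringI)
  show "abelian_group (free_alg d)"
  proof (rule abelian_groupI)
    fix f g assume f: "f \<in> carrier (free_alg d)" and g: "g \<in> carrier (free_alg d)"
    have "{w. f w + g w \<noteq> 0} \<subseteq> {w. f w \<noteq> 0} \<union> {w. g w \<noteq> 0}"
      by auto
    then have "finite {w. f w + g w \<noteq> 0}"
      using f g by (auto simp: free_alg_def intro: finite_subset)
    moreover have "set w \<subseteq> {1..d}" if "f w + g w \<noteq> 0" for w
    proof -
      have "f w \<noteq> 0 \<or> g w \<noteq> 0"
        using that by auto
      then show ?thesis
        using f g by (auto simp: free_alg_def)
    qed
    ultimately show "f \<oplus>\<^bsub>free_alg d\<^esub> g \<in> carrier (free_alg d)"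
      by (simp add: free_alg_def)
  next
    fix f assume "f \<in> carrier (free_alg d)"
    then show "\<exists>g\<in>carrier (free_alg d). g \<oplus>\<^bsub>free_alg d\<^esub> f = \<zero>\<^bsub>free_alg d\<^esub>"
      by (intro bexI[where x = "\<lambda>w. - f w"]) (auto simp: free_alg_def)
  qed (auto simp: free_alg_def algebra_simps)
next
  have "finite {w :: nat list. w = []}"
    by simp
  then show "monoid (free_alg d)"
    by (intro monoidI free_alg_mult_closed free_alg_mult_assoc free_alg_one)
      (auto simp: free_alg_def)
qed (auto simp: free_alg_def case_prod_beta algebra_simps sum.distrib)


section \<open>Generalized Clifford algebras\<close>

definition clif_omega :: "nat \<Rightarrow> complex" where
  "clif_omega m = exp (2 * of_real pi * \<i> / of_nat m)"

definition clif_relators :: "nat \<Rightarrow> nat \<Rightarrow> (nat list \<Rightarrow> complex) set" where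
  "clif_relators m d =
     {free_gen j [^]\<^bsub>free_alg d\<^esub> m \<ominus>\<^bsub>free_alg d\<^esub> \<one>\<^bsub>free_alg d\<^esub> | j. j \<in> {1..d}} \<union>
     {free_gen k \<otimes>\<^bsub>free_alg d\<^esub> free_gen l \<ominus>\<^bsub>free_alg d\<^esub>
        free_const (clif_omega m) \<otimes>\<^bsub>free_alg d\<^esub> (free_gen l \<otimes>\<^bsub>free_alg d\<^esub> free_gen k)
      | k l. k \<in> {1..d} \<and> l \<in> {1..d} \<and> k < l}"

lemma clif_relators_closed: "clif_relators m d \<subseteq> carrier (free_alg d)"
proof -
  interpret ring "free_alg d"
    by (rule free_alg_ring)
  have gen: "free_gen j \<in> carrier (free_alg d)" if "j \<in> {1..d}" for j
    using that by (auto simp: free_alg_def free_gen_def)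
  have const: "free_const c \<in> carrier (free_alg d)" for c
    by (auto simp: free_alg_def free_const_def)
  show ?thesis
    unfolding clif_relators_def
    by (auto intro!: minus_closed m_closed nat_pow_closed gen const)
qed

definition clif_ideal :: "nat \<Rightarrow> nat \<Rightarrow> (nat list \<Rightarrow> complex) set" where
  "clif_ideal m d = Idl\<^bsub>free_alg d\<^esub> (clif_relators m d)"

type_synonym clif = "(nat list \<Rightarrow> complex) set"

definition clif_alg :: "nat \<Rightarrow> nat \<Rightarrow> clif ring" where
  "clif_alg m d = free_alg d Quot clif_ideal m d"

lemma clif_alg_ring: "ring (clif_alg m d)"
  unfolding clif_alg_def clif_ideal_def
  by (intro ideal.quotient_is_ring ring.genideal_ideal free_alg_ring clif_relators_closed)

text \<open>The scalar \<open>c\<close>, identified with \<open>c\<close> times the identity. The scalar multiple of \<open>U\<close> by \<open>c\<close>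
  is the product of \<open>clif_scalar m d c\<close> and \<open>U\<close>.\<close>

definition clif_scalar :: "nat \<Rightarrow> nat \<Rightarrow> complex \<Rightarrow> clif" where
  "clif_scalar m d c = clif_ideal m d +>\<^bsub>free_alg d\<^esub> free_const c"

definition clif_gen :: "nat \<Rightarrow> nat \<Rightarrow> nat \<Rightarrow> clif" where
  "clif_gen m d j = clif_ideal m d +>\<^bsub>free_alg d\<^esub> free_gen j"

text \<open>The basis element \<open>e\<^sub>1^(J 1) \<cdots> e\<^sub>d^(J d)\<close>, factors in increasing order of the generators.\<close>

definition clif_monomial :: "nat \<Rightarrow> nat \<Rightarrow> (nat \<Rightarrow> nat) \<Rightarrow> clif" where
  "clif_monomial m d J =
     foldr (\<lambda>k x. (clif_gen m d k [^]\<^bsub>clif_alg m d\<^esub> J k) \<otimes>\<^bsub>clif_alg m d\<^esub> x)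
       [1..<Suc d] \<one>\<^bsub>clif_alg m d\<^esub>"

definition clif_exponents :: "nat \<Rightarrow> nat \<Rightarrow> (nat \<Rightarrow> nat) set" where
  "clif_exponents m d = {1..d} \<rightarrow>\<^sub>E {0..<m}"

definition clif_lincomb :: "nat \<Rightarrow> nat \<Rightarrow> ((nat \<Rightarrow> nat) \<Rightarrow> complex) \<Rightarrow> clif" where
  "clif_lincomb m d u =
     (\<Oplus>\<^bsub>clif_alg m d\<^esub>J\<in>clif_exponents m d.
        clif_scalar m d (u J) \<otimes>\<^bsub>clif_alg m d\<^esub> clif_monomial m d J)"

definition clif_grade0 :: "nat \<Rightarrow> nat \<Rightarrow> clif \<Rightarrow> complex" where
  "clif_grade0 m d U =
     (THE c. \<exists>u. U = clif_lincomb m d u \<and> c = u (\<lambda>k\<in>{1..d}. 0))"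


section \<open>Matrix representations of minimal dimension\<close>

definition clif_N :: "nat \<Rightarrow> nat \<Rightarrow> nat" where
  "clif_N m d = m ^ ((d + 1) div 2)"

definition clif_rep_carrier :: "nat \<Rightarrow> nat \<Rightarrow> complex mat set" where
  "clif_rep_carrier m d =
     (if even d then carrier_mat (m ^ (d div 2)) (m ^ (d div 2))
      else {diag_block_mat Bs | Bs.
              length Bs = m \<and>
              set Bs \<subseteq> carrier_mat (m ^ ((d - 1) div 2)) (m ^ ((d - 1) div 2))})"

text \<open>Compatibility with scalars turns a ring isomorphism into an isomorphism of unital complex
  algebras. The determinant of \<open>U\<close> is \<open>det (\<gamma> U)\<close> for any \<open>\<gamma>\<close> with \<open>clif_min_rep m d \<gamma>\<close>.\<close>

definition clif_min_rep :: "nat \<Rightarrow> nat \<Rightarrow> (clif \<Rightarrow> complex mat) \<Rightarrow> bool" where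
  "clif_min_rep m d \<gamma> \<longleftrightarrow>
     \<gamma> \<in> ring_iso (clif_alg m d)
            ((ring_mat TYPE(complex) (clif_N m d) ())\<lparr>carrier := clif_rep_carrier m d\<rparr>) \<and>
     (\<forall>c. \<gamma> (clif_scalar m d c) = c \<cdot>\<^sub>m 1\<^sub>m (clif_N m d))"


section \<open>The recursion\<close>

text \<open>\<open>clif_U m d U k\<close> and \<open>clif_C m d U k\<close> are only meaningful for \<open>k \<ge> 1\<close>; the value of
  \<open>clif_U\<close> at 0 is a placeholder. With \<open>N = clif_N m d\<close>, the recursion and
  \<open>Det(\<lambda>e - U) = \<lambda>\<^sup>N - C\<^sub>1 \<lambda>\<^sup>N\<^sup>-\<^sup>1 - \<cdots> - C\<^sub>N\<close> give \<open>U (U\<^sub>N\<^sub>-\<^sub>1 - C\<^sub>N\<^sub>-\<^sub>1) = C\<^sub>N = (-1)\<^sup>N\<^sup>+\<^sup>1 Det(U)\<close>. Hence the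
  inverse of \<open>U\<close> is \<open>(-1)\<^sup>N (C\<^sub>N\<^sub>-\<^sub>1 - U\<^sub>N\<^sub>-\<^sub>1) / Det(U)\<close>; the sign disappears exactly when \<open>N\<close>
  (equivalently, for \<open>d \<ge> 1\<close>, \<open>m\<close>) is even. It cannot be dropped in general: for \<open>m = 3\<close>,
  \<open>d = 1\<close>, \<open>U = e\<close> one gets \<open>C\<^sub>2 = -3\<close>, \<open>U\<^sub>2 = -2e\<close>, \<open>Det(U) = 1\<close>.\<close>

fun clif_U :: "nat \<Rightarrow> nat \<Rightarrow> clif \<Rightarrow> nat \<Rightarrow> clif"
  and clif_C :: "nat \<Rightarrow> nat \<Rightarrow> clif \<Rightarrow> nat \<Rightarrow> complex" where
  "clif_U m d U 0 = \<zero>\<^bsub>clif_alg m d\<^esub>"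
| "clif_U m d U (Suc 0) = U"
| "clif_U m d U (Suc (Suc k)) =
     U \<otimes>\<^bsub>clif_alg m d\<^esub>
       (clif_U m d U (Suc k) \<ominus>\<^bsub>clif_alg m d\<^esub> clif_scalar m d (clif_C m d U (Suc k)))"
| "clif_C m d U k = of_nat (clif_N m d) / of_nat k * clif_grade0 m d (clif_U m d U k)"

end

theory Submission
  imports Defs "Jordan_Normal_Form.Char_Poly"
begin

text \<open>Let \<open>\<gamma>\<close> be a minimal representation. The coefficients of \<open>adj (x - \<gamma> U)\<close> satisfy the recursion for
  \<open>U\<^sub>k\<close> as soon as \<open>C\<^sub>k = tr (\<gamma> U\<^sub>k) / k\<close>, so the formula reduces to \<open>N \<langle>U\<rangle>\<^sub>0 = tr (\<gamma> U)\<close>, that is, to the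
  vanishing of the trace on every monomial \<open>x \<noteq> e\<close>. There are as many monomials as matrix units in
  the image of \<open>\<gamma>\<close> and they span, hence they form a basis. Left multiplication by \<open>x\<close> permutes this basis
  up to scalars and without fixed points, so its trace is 0; computed with matrix units instead,
  the same trace is a positive multiple of \<open>tr (\<gamma> x)\<close>.\<close>

section \<open>The Faddeev--LeVerrier recursion\<close>

text \<open>The first two equations compare coefficients in \<open>(x - A) adj (x - A) = p(x)\<close>; the third is
  Jacobi's formula \<open>p'(x) = tr (adj (x - A))\<close>.\<close>

lemma adj_char_poly_coeff:
  fixes A :: "'a :: idom mat"
  assumes A: "A \<in> carrier_mat n n"
  defines "b \<equiv> \<lambda>k. mat n n (\<lambda>ij. coeff (adj_mat (char_poly_matrix A) $$ ij) k)"
  shows "A * b 0 = (- coeff (char_poly A) 0) \<cdot>\<^sub>m 1\<^sub>m n"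
    and "b k = A * b (Suc k) + coeff (char_poly A) (Suc k) \<cdot>\<^sub>m 1\<^sub>m n"
    and "(\<Sum>i<n. b k $$ (i, i)) = of_nat (Suc k) * coeff (char_poly A) (Suc k)"
proof -
  let ?M = "char_poly_matrix A" and ?p = "char_poly A"
  let ?B = "adj_mat ?M"
  have M: "?M \<in> carrier_mat n n"
    using A by simp
  \<comment> \<open>The (i, j) entry of (x - A) adj (x - A) = p I; \<open>pCons 0\<close> is
    multiplication by x.\<close>
  have entry: "pCons 0 (?B $$ (i, j)) - (\<Sum>l<n. smult (A $$ (i, l)) (?B $$ (l, j))) =
      (if i = j then ?p else 0)" if "i < n" "j < n" for i j
  proof -
    have "(?M * ?B) $$ (i, j) = (\<Sum>l<n. ?M $$ (i, l) * ?B $$ (l, j))"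
      using that M adj_mat(1)[OF M] by (simp add: scalar_prod_def lessThan_atLeast0)
    also have "\<dots> = (\<Sum>l<n. (if i = l then pCons 0 (?B $$ (l, j)) else 0)
        - smult (A $$ (i, l)) (?B $$ (l, j)))"
      using that A by (intro sum.cong) (auto simp: char_poly_matrix_def algebra_simps)
    also have "\<dots> = pCons 0 (?B $$ (i, j)) - (\<Sum>l<n. smult (A $$ (i, l)) (?B $$ (l, j)))"
      using that by (simp add: sum_subtractf)
    finally show ?thesis
      using that adj_mat(2)[OF M] by (simp add: char_poly_def split: if_splits)
  qed
  \<comment> \<open>Coefficient of x^k. The shift by x contributes nothing at k = 0, which is why
    \<open>b 0\<close> obeys a separate equation.\<close>
  have cf: "(case k of 0 \<Rightarrow> 0 | Suc l \<Rightarrow> coeff (?B $$ (i, j)) l)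
      - (\<Sum>l<n. A $$ (i, l) * coeff (?B $$ (l, j)) k) = (if i = j then coeff ?p k else 0)"
    if "i < n" "j < n" for i j k
    using arg_cong[OF entry[OF that], of "\<lambda>q. coeff q k"]
    by (simp add: coeff_sum coeff_pCons)
  show "A * b 0 = (- coeff ?p 0) \<cdot>\<^sub>m 1\<^sub>m n"
  proof (rule eq_matI, goal_cases)
    case (1 i j)
    then show ?case
      using cf[of i j 0] A
      by (simp add: b_def scalar_prod_def lessThan_atLeast0 minus_equation_iff split: if_splits)
  qed (use A in \<open>auto simp: b_def\<close>)
  show "b k = A * b (Suc k) + coeff ?p (Suc k) \<cdot>\<^sub>m 1\<^sub>m n"
  proof (rule eq_matI, goal_cases)
    case (1 i j)
    then show ?case
      using cf[of i j "Suc k"] A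
      by (simp add: b_def scalar_prod_def lessThan_atLeast0 algebra_simps split: if_splits)
  qed (use A in \<open>auto simp: b_def\<close>)
  \<comment> \<open>A diagonal cofactor has sign (-1)^(2i) = 1 and is the characteristic polynomial
    of a principal submatrix; p' is the sum of these.\<close>
  have diag: "?B $$ (i, i) = char_poly (mat_delete A i i)" if "i < n" for i
  proof -
    have "mat_delete ?M i i = char_poly_matrix (mat_delete A i i)"
      using A that
      by (intro eq_matI) (auto simp: mat_delete_def char_poly_matrix_def)
    then show ?thesis
      using that M
      by (auto simp: adj_mat_def cofactor_def char_poly_def simp flip: mult_2)
  qed
  have "(\<Sum>i<n. b k $$ (i, i)) = coeff (pderiv ?p) k"
    by (simp add: b_def diag pderiv_char_poly[OF A] coeff_sum)
  then show "(\<Sum>i<n. b k $$ (i, i)) = of_nat (Suc k) * coeff ?p (Suc k)"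
    by (simp add: coeff_pderiv)
qed

lemma smult_zero: "(0 :: 'a :: comm_ring_1) \<cdot>\<^sub>m 1\<^sub>m n = 0\<^sub>m n n"
  and smult_one: "(1 :: 'a :: comm_ring_1) \<cdot>\<^sub>m A = A"
  and smult_smult: "a \<cdot>\<^sub>m (b \<cdot>\<^sub>m A) = (a * b :: 'a :: comm_ring_1) \<cdot>\<^sub>m A"
  by (auto simp: mult.assoc)

text \<open>By induction \<open>Y k\<close> is A b(n-k). The trace identity then forces
  \<open>c k\<close> to be minus the coefficient of x^(n-k) in p, so subtracting \<open>c k\<close>
  from \<open>Y k\<close> leaves b(n-k-1). At k = n-1 this is b(0), and A b(0) = -p(0).\<close>

lemma faddeev_leverrier:
  fixes A :: "'a :: field_char_0 mat" and Y :: "nat \<Rightarrow> 'a mat" and c :: "nat \<Rightarrow> 'a"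
  assumes A: "A \<in> carrier_mat n n" and n: "n \<ge> 2"
    and Y1: "Y 1 = A"
    and YS: "\<And>k. 1 \<le> k \<Longrightarrow> Y (Suc k) = A * (Y k - c k \<cdot>\<^sub>m 1\<^sub>m n)"
    and c: "\<And>k. 1 \<le> k \<Longrightarrow> c k = (\<Sum>i<n. Y k $$ (i, i)) / of_nat k"
  shows "A * (Y (n - 1) - c (n - 1) \<cdot>\<^sub>m 1\<^sub>m n) = ((-1) ^ Suc n * det A) \<cdot>\<^sub>m 1\<^sub>m n"
proof -
  let ?p = "char_poly A"
  define b where "b k = mat n n (\<lambda>ij. coeff (adj_mat (char_poly_matrix A) $$ ij) k)" for k
  have b0: "A * b 0 = (- coeff ?p 0) \<cdot>\<^sub>m 1\<^sub>m n"
    and bS: "\<And>k. b k = A * b (Suc k) + coeff ?p (Suc k) \<cdot>\<^sub>m 1\<^sub>m n"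
    and tr: "\<And>k. (\<Sum>i<n. b k $$ (i, i)) = of_nat (Suc k) * coeff ?p (Suc k)"
    unfolding b_def by (rule adj_char_poly_coeff[OF A])+
  have bc [simp]: "b k \<in> carrier_mat n n" for k
    by (simp add: b_def)
  have deg: "degree ?p = n" "coeff ?p n = 1"
    using degree_monic_char_poly[OF A] by auto
  define K where "K = Max ((\<lambda>ij. degree (adj_mat (char_poly_matrix A) $$ ij)) ` ({..<n} \<times> {..<n}))"
  have zero: "b k = 0\<^sub>m n n" if "k > K" for k
  proof (rule eq_matI, goal_cases)
    case (1 i j)
    then have "degree (adj_mat (char_poly_matrix A) $$ (i, j)) \<le> K"
      unfolding K_def by (intro Max_ge) auto
    then show ?case
      using 1 that by (simp add: b_def coeff_eq_0)
  qed (auto simp: b_def)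
  \<comment> \<open>Beyond the largest entry degree \<open>K\<close> of the adjugate,
    \<open>b\<close> vanishes trivially. The recursion carries this down to n, since p has no
    coefficients above n.\<close>
  have high: "b k = 0\<^sub>m n n" if "k \<ge> n" for k
  proof -
    have "k \<le> Suc (k + K)"
      by simp
    then show ?thesis
    proof (induction k rule: inc_induct)
      case base
      then show ?case
        by (intro zero) simp
    next
      case (step l)
      then show ?case
        using that A bS[of l] deg by (simp add: coeff_eq_0 smult_zero)
    qed
  qed
  \<comment> \<open>The trace of \<open>Y k\<close> is (q + 1 - n) = -k times the coefficient of
    x^(q+1), so the division by k in \<open>c\<close> recovers that coefficient up to sign.\<close>
  have sub: "Y k - c k \<cdot>\<^sub>m 1\<^sub>m n = b q"
    if k: "1 \<le> k" "k + Suc q = n" and Y: "Y k = A * b (Suc q)" for k q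
  proof -
    have diag: "Y k $$ (i, i) = b q $$ (i, i) - coeff ?p (Suc q)" if "i < n" for i
      using bS[of q] that A unfolding Y by (simp add: b_def)
    have "(\<Sum>i<n. Y k $$ (i, i)) = (of_nat (Suc q) - of_nat n) * coeff ?p (Suc q)"
      by (simp add: diag sum_subtractf tr left_diff_distrib del: of_nat_Suc)
    also have "of_nat (Suc q) - of_nat n = - (of_nat k :: 'a)"
      by (simp flip: k(2))
    finally have ck: "c k = - coeff ?p (Suc q)"
      using c[OF k(1)] k(1) by simp
    show ?thesis
      using bS[of q] A unfolding Y ck by (intro eq_matI) auto
  qed
  have main: "Y k = A * b q" if "1 \<le> k" "k + q = n" "1 \<le> q" for k q
    using that
  proof (induction k arbitrary: q rule: dec_induct)
    case base
    \<comment> \<open>Here q = n-1: the next coefficient matrix is zero and p is monic.\<close>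
    have "b q = 1\<^sub>m n"
      using bS[of q] high[of n] deg A n base by (simp add: smult_one)
    then show ?case
      using Y1 A by simp
  next
    case (step k)
    then show ?case
      using YS[of k] sub[of k q] by simp
  qed
  have "Y (n - 1) - c (n - 1) \<cdot>\<^sub>m 1\<^sub>m n = b 0"
    using n by (intro sub main) auto
  moreover have "coeff ?p 0 = (-1) ^ n * det A"
  proof -
    have "poly ?p 0 = det ((-1) \<cdot>\<^sub>m A)"
      unfolding char_poly_def
      by (rule poly_det_cong[of _ n]) (use A in \<open>auto simp: char_poly_matrix_def\<close>)
    then show ?thesis
      using A by (simp add: poly_0_coeff_0)
  qed
  ultimately show ?thesis
    using b0 by simp
qed

text \<open>A right inverse of a square matrix is a left inverse. Arbitrary index sets are allowed
  because rows will be matrix positions and columns exponents; \<open>f\<close> and \<open>g\<close>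
  enumerate them.\<close>

lemma sum_mult_delta_commute:
  fixes p :: "'a \<Rightarrow> 'b \<Rightarrow> 'c :: field" and q :: "'b \<Rightarrow> 'a \<Rightarrow> 'c"
  assumes fin: "finite A" "finite B" and card: "card A = card B"
    and pq: "\<And>a a'. a \<in> A \<Longrightarrow> a' \<in> A \<Longrightarrow> (\<Sum>k\<in>B. p a k * q k a') = (if a = a' then 1 else 0)"
    and k: "k \<in> B" and l: "l \<in> B"
  shows "(\<Sum>a\<in>A. q k a * p a l) = (if k = l then 1 else 0)"
proof -
  let ?n = "card A"
  obtain f where f: "bij_betw f {0..<?n} A"
    using ex_bij_betw_nat_finite[OF fin(1)] by blast
  obtain g where g: "bij_betw g {0..<?n} B"
    using ex_bij_betw_nat_finite[OF fin(2)] card by metis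
  define P where "P = mat ?n ?n (\<lambda>(i, j). p (f i) (g j))"
  define Q where "Q = mat ?n ?n (\<lambda>(i, j). q (g i) (f j))"
  have f': "f i \<in> A" if "i < ?n" for i
    using bij_betwE[OF f] that by auto
  have "P * Q = 1\<^sub>m ?n"
  proof (rule eq_matI, goal_cases)
    case (1 i j)
    then have "(P * Q) $$ (i, j) = (\<Sum>k\<in>{0..<?n}. p (f i) (g k) * q (g k) (f j))"
      by (simp add: P_def Q_def scalar_prod_def)
    also have "\<dots> = (\<Sum>k\<in>B. p (f i) k * q k (f j))"
      by (rule sum.reindex_bij_betw[OF g])
    also have "\<dots> = (if i = j then 1 else 0)"
      using 1 pq f' bij_betw_imp_inj_on[OF f] by (auto simp: inj_on_def)
    finally show ?case
      using 1 by simp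
  qed (auto simp: P_def Q_def)
  then have QP: "Q * P = 1\<^sub>m ?n"
    by (intro mat_mult_left_right_inverse[of P ?n Q]) (auto simp: P_def Q_def)
  obtain i j where ij: "i < ?n" "j < ?n" "k = g i" "l = g j"
    using k l bij_betw_imp_surj_on[OF g] by (force simp: image_iff)
  have "(\<Sum>a\<in>A. q k a * p a l) = (\<Sum>x\<in>{0..<?n}. q k (f x) * p (f x) l)"
    by (rule sum.reindex_bij_betw[OF f, symmetric])
  also have "\<dots> = (Q * P) $$ (i, j)"
    using ij by (simp add: P_def Q_def scalar_prod_def)
  also have "\<dots> = (if k = l then 1 else 0)"
    using ij bij_betw_imp_inj_on[OF g] by (auto simp: QP inj_on_def)
  finally show ?thesis .
qed

text \<open>Trades the list of blocks for a condition on entries, which matrix units satisfy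
  visibly. The induction splits off the first block; shifting an index by n raises its block number
  by one.\<close>

lemma diag_block_mat_carrier:
  assumes "n > 0"
  shows "{diag_block_mat Bs | Bs. length Bs = b \<and> set Bs \<subseteq> carrier_mat n n} =
    {X \<in> carrier_mat (b * n) (b * n).
       \<forall>i < b * n. \<forall>j < b * n. i div n \<noteq> j div n \<longrightarrow> X $$ (i, j) = (0 :: 'a :: zero)}"
  (is "?L b = ?R b")
proof (induction b)
  case 0
  show ?case
    by auto
next
  case (Suc b)
  show ?case
  proof (intro equalityI subsetI)
    fix X assume "X \<in> ?L (Suc b)"
    then obtain Bs where Bs: "length Bs = Suc b" "set Bs \<subseteq> carrier_mat n n" "X = diag_block_mat Bs"
      by auto
    then obtain A As where As: "Bs = A # As"
      by (cases Bs) auto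
    have A: "A \<in> carrier_mat n n"
      using Bs As by auto
    have D: "diag_block_mat As \<in> ?R b"
      using Bs As unfolding Suc[symmetric] by auto
    have X: "X = four_block_mat A (0\<^sub>m n (b * n)) (0\<^sub>m (b * n) n) (diag_block_mat As)"
      using Bs As A D by (auto simp: Let_def)
    show "X \<in> ?R (Suc b)"
      using A D assms unfolding X
      by (auto simp: le_div_geq not_less)
  next
    fix X assume X: "X \<in> ?R (Suc b)"
    define A where "A = mat n n (\<lambda>ij. X $$ ij)"
    define D where "D = mat (b * n) (b * n) (\<lambda>(i, j). X $$ (i + n, j + n))"
    have "D \<in> ?R b"
      using X assms by (auto simp: D_def)
    then obtain As where As: "length As = b" "set As \<subseteq> carrier_mat n n" "D = diag_block_mat As"
      unfolding Suc[symmetric] by auto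
    have "X = four_block_mat A (0\<^sub>m n (b * n)) (0\<^sub>m (b * n) n) D"
      using X assms
      by (intro eq_matI) (auto simp: A_def D_def le_div_geq not_less)
    then have "X = diag_block_mat (A # As)"
      by (simp add: As(3)[symmetric] Let_def A_def D_def)
    then show "X \<in> ?L (Suc b)"
      using As by (auto intro!: exI[of _ "A # As"] simp: A_def)
  qed
qed

section \<open>The generalized Clifford algebra is spanned by its monomials\<close>

text \<open>Only the splitting with an empty word on the side of the constant contributes. The two
  sides agree, so scalars are central.\<close>

lemma free_alg_const:
  fixes f :: "nat list \<Rightarrow> complex"
  shows "free_const c \<otimes>\<^bsub>free_alg d\<^esub> f = (\<lambda>w. c * f w)"
    and "f \<otimes>\<^bsub>free_alg d\<^esub> free_const c = (\<lambda>w. c * f w)"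
proof -
  have "(\<Sum>(u, v) \<in> {(u, v). u @ v = w}. free_const c u * f v) =
      (\<Sum>(u, v) \<in> {([] :: nat list, w)}. free_const c u * f v)" for w
    by (rule sum.mono_neutral_right) (auto simp: finite_splits free_const_def split: if_splits)
  moreover have "(\<Sum>(u, v) \<in> {(u, v). u @ v = w}. f u * free_const c v) =
      (\<Sum>(u, v) \<in> {(w, [] :: nat list)}. f u * free_const c v)" for w
    by (rule sum.mono_neutral_right) (auto simp: finite_splits free_const_def split: if_splits)
  ultimately show "free_const c \<otimes>\<^bsub>free_alg d\<^esub> f = (\<lambda>w. c * f w)"
    and "f \<otimes>\<^bsub>free_alg d\<^esub> free_const c = (\<lambda>w. c * f w)"
    by (simp_all add: free_alg_def free_const_def mult.commute)
qed

definition free_word :: "nat list \<Rightarrow> nat list \<Rightarrow> complex" where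
  "free_word u = (\<lambda>w. if w = u then 1 else 0)"

lemma free_word_Cons: "free_word (j # w) = free_gen j \<otimes>\<^bsub>free_alg d\<^esub> free_word w"
proof
  fix x :: "nat list"
  have "(free_gen j \<otimes>\<^bsub>free_alg d\<^esub> free_word w) x =
      (\<Sum>p \<in> {(u, v). u @ v = x}. if p = ([j], w) then 1 else 0)"
    by (auto simp: free_alg_def free_gen_def free_word_def case_prod_beta intro!: sum.cong)
  also have "\<dots> = free_word (j # w) x"
    by (simp add: finite_splits free_word_def)
  finally show "free_word (j # w) x = (free_gen j \<otimes>\<^bsub>free_alg d\<^esub> free_word w) x" ..
qed

lemma free_alg_carrier:
  "free_const c \<in> carrier (free_alg d)"
  "j \<in> {1..d} \<Longrightarrow> free_gen j \<in> carrier (free_alg d)"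
  "set w \<subseteq> {1..d} \<Longrightarrow> free_word w \<in> carrier (free_alg d)"
  by (auto simp: free_alg_def free_const_def free_gen_def free_word_def)

section \<open>The quotient map, scalars and the defining relations\<close>

locale clifford =
  fixes m d :: nat
  assumes m_ge_2: "m \<ge> 2"
begin

abbreviation R where "R \<equiv> clif_alg m d"

sublocale ring R
  by (rule clif_alg_ring)

definition proj :: "(nat list \<Rightarrow> complex) \<Rightarrow> clif" where
  "proj f = clif_ideal m d +>\<^bsub>free_alg d\<^esub> f"

lemma ideal: "ideal (clif_ideal m d) (free_alg d)"
  unfolding clif_ideal_def by (intro ring.genideal_ideal free_alg_ring clif_relators_closed)

sublocale proj: ring_hom_ring "free_alg d" R proj
proof -
  have "proj = (+>\<^bsub>free_alg d\<^esub>) (clif_ideal m d)"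
    by (auto simp: proj_def)
  then show "ring_hom_ring (free_alg d) R proj"
    using ideal.rcos_ring_hom_ring[OF ideal] by (simp add: clif_alg_def)
qed

lemma carrier_eq: "carrier R = proj ` carrier (free_alg d)"
  by (auto simp: clif_alg_def FactRing_def A_RCOSETS_def' proj_def)

text \<open>Turns each relator into an equation in \<open>R\<close>; \<open>gen_pow\<close> and
  \<open>gen_commute\<close> are its two instances.\<close>

lemma proj_eq:
  assumes "f \<in> carrier (free_alg d)" "g \<in> carrier (free_alg d)"
    and "f \<ominus>\<^bsub>free_alg d\<^esub> g \<in> clif_relators m d"
  shows "proj f = proj g"
proof -
  interpret I: ideal "clif_ideal m d" "free_alg d"
    by (rule ideal)
  have "f \<ominus>\<^bsub>free_alg d\<^esub> g \<in> clif_ideal m d"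
    using assms ring.genideal_self[OF free_alg_ring clif_relators_closed]
    by (auto simp: clif_ideal_def)
  then have "proj (f \<ominus>\<^bsub>free_alg d\<^esub> g) = \<zero>\<^bsub>R\<^esub>"
    by (simp add: proj_def I.a_rcos_const clif_alg_def FactRing_def)
  then show ?thesis
    using assms minus_equality[of "proj f" "\<ominus>\<^bsub>R\<^esub> proj g"] by (simp add: a_minus_def)
qed

abbreviation scal where "scal \<equiv> clif_scalar m d"
abbreviation gen where "gen \<equiv> clif_gen m d"

lemma scal_eq: "scal c = proj (free_const c)"
  by (simp add: clif_scalar_def proj_def)

lemma gen_eq: "gen j = proj (free_gen j)"
  by (simp add: clif_gen_def proj_def)

lemma scal_closed [simp]: "scal c \<in> carrier R"
  by (simp add: scal_eq free_alg_carrier)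

lemma gen_closed [simp]: "j \<in> {1..d} \<Longrightarrow> gen j \<in> carrier R"
  unfolding gen_eq by (intro proj.hom_closed free_alg_carrier)

lemma scal_0: "scal 0 = \<zero>\<^bsub>R\<^esub>"
proof -
  have "free_const 0 = \<zero>\<^bsub>free_alg d\<^esub>"
    by (simp add: free_const_def free_alg_def)
  then show ?thesis
    by (simp add: scal_eq)
qed

lemma scal_1: "scal 1 = \<one>\<^bsub>R\<^esub>"
proof -
  have "free_const 1 = \<one>\<^bsub>free_alg d\<^esub>"
    by (simp add: free_const_def free_alg_def)
  then show ?thesis
    by (simp add: scal_eq)
qed

lemma scal_add: "scal (a + b) = scal a \<oplus>\<^bsub>R\<^esub> scal b"
proof -
  have "free_const (a + b) = free_const a \<oplus>\<^bsub>free_alg d\<^esub> free_const b"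
    by (auto simp: free_const_def free_alg_def)
  then show ?thesis
    by (simp add: scal_eq free_alg_carrier)
qed

lemma scal_mult: "scal (a * b) = scal a \<otimes>\<^bsub>R\<^esub> scal b"
proof -
  have "free_const (a * b) = free_const a \<otimes>\<^bsub>free_alg d\<^esub> free_const b"
    unfolding free_alg_const by (auto simp: free_const_def)
  then show ?thesis
    by (simp add: scal_eq free_alg_carrier)
qed

lemma scal_comm: "x \<in> carrier R \<Longrightarrow> x \<otimes>\<^bsub>R\<^esub> scal c = scal c \<otimes>\<^bsub>R\<^esub> x"
  unfolding carrier_eq scal_eq
  by (auto simp: free_alg_const free_alg_carrier simp flip: proj.hom_mult)

lemma scal_inverse: "c \<noteq> 0 \<Longrightarrow> scal (inverse c) \<otimes>\<^bsub>R\<^esub> scal c = \<one>\<^bsub>R\<^esub>"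
  by (simp add: scal_1 flip: scal_mult)

lemma gen_pow:
  assumes "j \<in> {1..d}"
  shows "gen j [^]\<^bsub>R\<^esub> m = \<one>\<^bsub>R\<^esub>"
proof -
  have "proj (free_gen j [^]\<^bsub>free_alg d\<^esub> m) = proj \<one>\<^bsub>free_alg d\<^esub>"
    using assms free_alg_carrier(2)[OF assms]
    by (intro proj_eq) (auto simp: clif_relators_def)
  then show ?thesis
    using free_alg_carrier(2)[OF assms] by (simp add: gen_eq proj.hom_nat_pow)
qed

lemma gen_commute:
  assumes "k \<in> {1..d}" "l \<in> {1..d}" "k < l"
  shows "gen k \<otimes>\<^bsub>R\<^esub> gen l = scal (clif_omega m) \<otimes>\<^bsub>R\<^esub> (gen l \<otimes>\<^bsub>R\<^esub> gen k)"
proof -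
  note [simp] = free_alg_carrier(1) free_alg_carrier(2)[OF assms(1)] free_alg_carrier(2)[OF assms(2)]
  have "proj (free_gen k \<otimes>\<^bsub>free_alg d\<^esub> free_gen l) = proj (free_const (clif_omega m)
      \<otimes>\<^bsub>free_alg d\<^esub> (free_gen l \<otimes>\<^bsub>free_alg d\<^esub> free_gen k))"
  proof (rule proj_eq)
    show "free_gen k \<otimes>\<^bsub>free_alg d\<^esub> free_gen l \<ominus>\<^bsub>free_alg d\<^esub> free_const (clif_omega m)
      \<otimes>\<^bsub>free_alg d\<^esub> (free_gen l \<otimes>\<^bsub>free_alg d\<^esub> free_gen k) \<in> clif_relators m d"
      using assms unfolding clif_relators_def by blast
  qed simp_all
  then show ?thesis
    by (simp add: gen_eq scal_eq)
qed

text \<open>Modulo nonzero scalars the generators commute, so the reordering factors, which are powers of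
  \<open>\<omega>\<close>, never have to be computed.\<close>

definition sim :: "clif \<Rightarrow> clif \<Rightarrow> bool" where
  "sim x y \<longleftrightarrow> x \<in> carrier R \<and> y \<in> carrier R \<and> (\<exists>c. c \<noteq> 0 \<and> x = scal c \<otimes>\<^bsub>R\<^esub> y)"

lemma sim_closed: "sim x y \<Longrightarrow> x \<in> carrier R" "sim x y \<Longrightarrow> y \<in> carrier R"
  by (auto simp: sim_def)

lemma sim_refl: "x \<in> carrier R \<Longrightarrow> sim x x"
  by (auto simp: sim_def scal_1 intro!: exI[of _ 1])

lemma sim_sym: "sim x y \<Longrightarrow> sim y x"
proof (clarsimp simp: sim_def)
  fix c :: complex assume "c \<noteq> 0" "y \<in> carrier R"
  then show "\<exists>c'. c' \<noteq> 0 \<and> y = scal c' \<otimes>\<^bsub>R\<^esub> (scal c \<otimes>\<^bsub>R\<^esub> y)"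
    by (intro exI[of _ "inverse c"]) (simp add: scal_inverse flip: m_assoc)
qed

lemma sim_trans [trans]: "sim x y \<Longrightarrow> sim y z \<Longrightarrow> sim x z"
proof (clarsimp simp: sim_def)
  fix a b :: complex assume "a \<noteq> 0" "b \<noteq> 0" "z \<in> carrier R"
  then show "\<exists>c. c \<noteq> 0 \<and> scal a \<otimes>\<^bsub>R\<^esub> (scal b \<otimes>\<^bsub>R\<^esub> z) = scal c \<otimes>\<^bsub>R\<^esub> z"
    by (intro exI[of _ "a * b"]) (simp add: scal_mult m_assoc)
qed

text \<open>Scalars are central, so both factors can be collected in front.\<close>

lemma sim_mult:
  assumes "sim x x'" "sim y y'"
  shows "sim (x \<otimes>\<^bsub>R\<^esub> y) (x' \<otimes>\<^bsub>R\<^esub> y')"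
proof -
  obtain a b where ab: "a \<noteq> 0" "b \<noteq> 0" "x = scal a \<otimes>\<^bsub>R\<^esub> x'" "y = scal b \<otimes>\<^bsub>R\<^esub> y'"
    and c [simp]: "x' \<in> carrier R" "y' \<in> carrier R"
    using assms by (auto simp: sim_def)
  have "x \<otimes>\<^bsub>R\<^esub> y = scal a \<otimes>\<^bsub>R\<^esub> (x' \<otimes>\<^bsub>R\<^esub> scal b) \<otimes>\<^bsub>R\<^esub> y'"
    by (simp add: ab m_assoc)
  also have "x' \<otimes>\<^bsub>R\<^esub> scal b = scal b \<otimes>\<^bsub>R\<^esub> x'"
    by (simp add: scal_comm)
  also have "scal a \<otimes>\<^bsub>R\<^esub> (scal b \<otimes>\<^bsub>R\<^esub> x') \<otimes>\<^bsub>R\<^esub> y' = scal (a * b) \<otimes>\<^bsub>R\<^esub> (x' \<otimes>\<^bsub>R\<^esub> y')"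
    by (simp add: scal_mult m_assoc)
  finally show ?thesis
    unfolding sim_def using ab sim_closed[OF assms(1)] sim_closed[OF assms(2)]
    by (intro conjI exI[of _ "a * b"]) auto
qed

definition scomm :: "clif \<Rightarrow> clif \<Rightarrow> bool" where
  "scomm x y \<longleftrightarrow> x \<in> carrier R \<and> y \<in> carrier R \<and> sim (x \<otimes>\<^bsub>R\<^esub> y) (y \<otimes>\<^bsub>R\<^esub> x)"

lemma scomm_sym: "scomm x y \<Longrightarrow> scomm y x"
  by (auto simp: scomm_def intro: sim_sym)

lemma scomm_one: "x \<in> carrier R \<Longrightarrow> scomm x \<one>\<^bsub>R\<^esub>"
  by (auto simp: scomm_def sim_refl)

lemma scomm_mult:
  assumes "scomm x y" "scomm x z"
  shows "scomm x (y \<otimes>\<^bsub>R\<^esub> z)"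
proof -
  have [simp]: "x \<in> carrier R" "y \<in> carrier R" "z \<in> carrier R"
    and xy: "sim (x \<otimes>\<^bsub>R\<^esub> y) (y \<otimes>\<^bsub>R\<^esub> x)" and xz: "sim (x \<otimes>\<^bsub>R\<^esub> z) (z \<otimes>\<^bsub>R\<^esub> x)"
    using assms by (auto simp: scomm_def)
  have "sim (x \<otimes>\<^bsub>R\<^esub> (y \<otimes>\<^bsub>R\<^esub> z)) (y \<otimes>\<^bsub>R\<^esub> x \<otimes>\<^bsub>R\<^esub> z)"
    using sim_mult[OF xy sim_refl[of z]] by (simp add: m_assoc)
  also have "sim \<dots> (y \<otimes>\<^bsub>R\<^esub> z \<otimes>\<^bsub>R\<^esub> x)"
    using sim_mult[OF sim_refl[of y] xz] by (simp add: m_assoc)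
  finally show ?thesis
    by (simp add: scomm_def)
qed

lemma scomm_pow: "scomm x y \<Longrightarrow> scomm x (y [^]\<^bsub>R\<^esub> (n :: nat))"
proof (induction n)
  case 0
  then show ?case
    using scomm_one by (simp add: scomm_def)
next
  case (Suc n)
  then show ?case
    by (simp add: scomm_mult)
qed

lemma scomm_gen:
  assumes "k \<in> {1..d}" "l \<in> {1..d}"
  shows "scomm (gen k) (gen l)"
proof -
  have less: "scomm (gen k) (gen l)" if kl: "k \<in> {1..d}" "l \<in> {1..d}" "k < l" for k l
    unfolding scomm_def sim_def
  \<comment> \<open>The factor is nonzero because it is a value of the exponential function.\<close>
  proof (intro conjI exI[of _ "clif_omega m"])
    show "gen k \<otimes>\<^bsub>R\<^esub> gen l = scal (clif_omega m) \<otimes>\<^bsub>R\<^esub> (gen l \<otimes>\<^bsub>R\<^esub> gen k)"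
      by (rule gen_commute[OF kl])
  qed (use kl in \<open>simp_all add: clif_omega_def\<close>)
  show ?thesis
  proof (cases k l rule: linorder_cases)
    assume "k < l"
    then show ?thesis
      by (rule less[OF assms])
  next
    assume "k = l"
    then show ?thesis
      using assms by (simp add: scomm_def sim_refl)
  next
    assume "l < k"
    then show ?thesis
      by (intro scomm_sym[OF less] assms)
  qed
qed

text \<open>\<open>clif_monomial\<close> with a variable list of letters, which makes induction on
  the list possible.\<close>

definition mon :: "nat list \<Rightarrow> (nat \<Rightarrow> nat) \<Rightarrow> clif" where
  "mon L J = foldr (\<lambda>k x. gen k [^]\<^bsub>R\<^esub> J k \<otimes>\<^bsub>R\<^esub> x) L \<one>\<^bsub>R\<^esub>"

lemma mon_simps [simp]:
  "mon [] J = \<one>\<^bsub>R\<^esub>"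
  "mon (k # L) J = gen k [^]\<^bsub>R\<^esub> J k \<otimes>\<^bsub>R\<^esub> mon L J"
  by (simp_all add: mon_def)

lemma mon_closed: "set L \<subseteq> {1..d} \<Longrightarrow> mon L J \<in> carrier R"
  by (induction L) auto

lemma mon_cong: "(\<And>k. k \<in> set L \<Longrightarrow> J k = K k) \<Longrightarrow> mon L J = mon L K"
  by (induction L) auto

lemma scomm_mon: "x \<in> carrier R \<Longrightarrow> (\<And>k. k \<in> set L \<Longrightarrow> scomm x (gen k)) \<Longrightarrow> scomm x (mon L J)"
proof (induction L)
  case Nil
  then show ?case
    by (simp add: scomm_one)
next
  case (Cons k L)
  then show ?case
    by (simp add: scomm_mult scomm_pow)
qed

text \<open>The power of the leading generator in the second factor moves left past the tail of the
  first, at the cost of a nonzero scalar; the tails are merged by induction.\<close>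

lemma mon_mult:
  "set L \<subseteq> {1..d} \<Longrightarrow> sim (mon L J \<otimes>\<^bsub>R\<^esub> mon L K) (mon L (\<lambda>k. J k + K k))"
proof (induction L)
  case Nil
  then show ?case
    by (simp add: sim_refl)
next
  case (Cons k L)
  let ?p = "mon L J" and ?q = "mon L K" and ?x = "gen k [^]\<^bsub>R\<^esub> J k" and ?y = "gen k [^]\<^bsub>R\<^esub> K k"
  have [simp]: "?p \<in> carrier R" "?q \<in> carrier R" "?x \<in> carrier R" "?y \<in> carrier R"
    using Cons mon_closed by auto
  have "scomm (gen k) ?p"
    using Cons by (auto intro!: scomm_mon scomm_gen)
  then have "sim (?p \<otimes>\<^bsub>R\<^esub> ?y) (?y \<otimes>\<^bsub>R\<^esub> ?p)"
    using scomm_pow[OF scomm_sym, of "gen k" ?p "K k"] by (simp add: scomm_def)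
  then have "sim (?x \<otimes>\<^bsub>R\<^esub> (?p \<otimes>\<^bsub>R\<^esub> ?y) \<otimes>\<^bsub>R\<^esub> ?q) (?x \<otimes>\<^bsub>R\<^esub> (?y \<otimes>\<^bsub>R\<^esub> ?p) \<otimes>\<^bsub>R\<^esub> ?q)"
    by (intro sim_mult[OF sim_mult] sim_refl) auto
  also have "?x \<otimes>\<^bsub>R\<^esub> (?y \<otimes>\<^bsub>R\<^esub> ?p) \<otimes>\<^bsub>R\<^esub> ?q = (?x \<otimes>\<^bsub>R\<^esub> ?y) \<otimes>\<^bsub>R\<^esub> (?p \<otimes>\<^bsub>R\<^esub> ?q)"
    by (simp add: m_assoc)
  also have "sim \<dots> ((?x \<otimes>\<^bsub>R\<^esub> ?y) \<otimes>\<^bsub>R\<^esub> mon L (\<lambda>k. J k + K k))"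
    using Cons by (intro sim_mult sim_refl) auto
  also have "?x \<otimes>\<^bsub>R\<^esub> ?y = gen k [^]\<^bsub>R\<^esub> (J k + K k)"
    using Cons by (simp add: nat_pow_mult)
  \<comment> \<open>This equation rewrites the left end of the chain into the product of the two
    monomials.\<close>
  also have "?x \<otimes>\<^bsub>R\<^esub> (?p \<otimes>\<^bsub>R\<^esub> ?y) \<otimes>\<^bsub>R\<^esub> ?q = ?x \<otimes>\<^bsub>R\<^esub> ?p \<otimes>\<^bsub>R\<^esub> (?y \<otimes>\<^bsub>R\<^esub> ?q)"
    by (simp add: m_assoc)
  finally show ?case
    by (simp only: mon_simps)
qed

lemma gen_pow_mod:
  assumes "k \<in> {1..d}"
  shows "gen k [^]\<^bsub>R\<^esub> (n mod m) = gen k [^]\<^bsub>R\<^esub> n"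
proof -
  let ?q = "n div m" and ?r = "n mod m"
  have "gen k [^]\<^bsub>R\<^esub> (m * ?q + ?r) = (gen k [^]\<^bsub>R\<^esub> m) [^]\<^bsub>R\<^esub> ?q \<otimes>\<^bsub>R\<^esub> gen k [^]\<^bsub>R\<^esub> ?r"
    using nat_pow_mult[OF gen_closed[OF assms], of "m * ?q" ?r]
      nat_pow_pow[OF gen_closed[OF assms], of m ?q] by argo
  also have "\<dots> = gen k [^]\<^bsub>R\<^esub> ?r"
    unfolding gen_pow[OF assms] nat_pow_one
    by (rule l_one[OF nat_pow_closed[OF gen_closed[OF assms]]])
  finally show ?thesis
    unfolding mult_div_mod_eq ..
qed

lemma mon_mod: "set L \<subseteq> {1..d} \<Longrightarrow> mon L (\<lambda>k. J k mod m) = mon L J"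
  by (induction L) (simp_all add: gen_pow_mod)

lemma mon_unit:
  "set L \<subseteq> {1..d} \<Longrightarrow> distinct L \<Longrightarrow>
    mon L (\<lambda>k. if k = j then 1 else 0) = (if j \<in> set L then gen j else \<one>\<^bsub>R\<^esub>)"
proof (induction L)
  case (Cons k L)
  then show ?case
    using mon_closed[of L "\<lambda>k. if k = j then 1 else 0"]
    by (cases "k = j") (simp_all split: if_splits)
qed simp

section \<open>Exponents modulo m and the reduction of words to monomials\<close>

abbreviation monomial where "monomial \<equiv> clif_monomial m d"
abbreviation E where "E \<equiv> clif_exponents m d"

lemma monomial_eq: "monomial J = mon [1..<Suc d] J"
  by (simp add: clif_monomial_def mon_def)

lemma letters: "set [1..<Suc d] = {1..d}"
  by auto

lemma monomial_closed [simp]: "monomial J \<in> carrier R"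
  unfolding monomial_eq by (intro mon_closed) auto

text \<open>Exponents add modulo m because e_j^m = e. The restriction to the letters keeps the
  result extensional, as membership in \<open>E\<close> demands.\<close>

definition exp_add :: "(nat \<Rightarrow> nat) \<Rightarrow> (nat \<Rightarrow> nat) \<Rightarrow> nat \<Rightarrow> nat" where
  "exp_add J K = (\<lambda>k\<in>{1..d}. (J k + K k) mod m)"

lemma exp_add_closed: "exp_add J K \<in> E"
  using m_ge_2 by (auto simp: exp_add_def clif_exponents_def)

text \<open>The scalar stays anonymous: the trace computation multiplies it by zero.\<close>

lemma monomial_mult: "\<exists>c. monomial J \<otimes>\<^bsub>R\<^esub> monomial K = scal c \<otimes>\<^bsub>R\<^esub> monomial (exp_add J K)"
proof -
  have "monomial (exp_add J K) = mon [1..<Suc d] (\<lambda>k. (J k + K k) mod m)"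
    unfolding monomial_eq exp_add_def by (rule mon_cong) auto
  also have "\<dots> = mon [1..<Suc d] (\<lambda>k. J k + K k)"
    by (rule mon_mod) auto
  finally show ?thesis
    using mon_mult[of "[1..<Suc d]" J K] letters by (auto simp: monomial_eq sim_def simp del: upt_Suc)
qed

text \<open>Translations of the group (Z/m)^d by nonzero elements have no fixed points.\<close>

lemma exp_add_eq:
  assumes "J \<in> E" "K \<in> E" "exp_add J K = K"
  shows "J = (\<lambda>k\<in>{1..d}. 0)"
proof
  fix k
  show "J k = (\<lambda>k\<in>{1..d}. 0) k"
  proof (cases "k \<in> {1..d}")
    case True
    then have "(J k + K k) mod m = K k"
      using fun_cong[OF assms(3), of k] by (simp add: exp_add_def)
    moreover have "J k < m" "K k < m"
      using assms True by (auto simp: clif_exponents_def)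
    ultimately show ?thesis
      using True by (auto simp: mod_if split: if_splits)
  next
    case False
    then show ?thesis
      using assms by (auto simp: clif_exponents_def PiE_def extensional_def)
  qed
qed

lemma finite_exponents: "finite E" and card_exponents: "card E = m ^ d"
  by (auto simp: clif_exponents_def card_PiE intro: finite_PiE)

lemma zero_exponent: "(\<lambda>k\<in>{1..d}. 0) \<in> E"
  using m_ge_2 by (auto simp: clif_exponents_def)

lemma monomial_zero: "monomial (\<lambda>k\<in>{1..d}. 0) = \<one>\<^bsub>R\<^esub>"
proof -
  have "mon L (\<lambda>k. 0) = \<one>\<^bsub>R\<^esub>" if "set L \<subseteq> {1..d}" for L
    using that by (induction L) auto
  moreover have "monomial (\<lambda>k\<in>{1..d}. 0) = mon [1..<Suc d] (\<lambda>k. 0)"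
    unfolding monomial_eq by (rule mon_cong) auto
  ultimately show ?thesis
    using letters by auto
qed

text \<open>This exponent function is 0 rather than undefined off the letters, so it is not in
  \<open>E\<close>; monomials read only the values on letters, and \<open>exp_add\<close> restores
  extensionality.\<close>

lemma gen_monomial:
  assumes "j \<in> {1..d}"
  shows "gen j = monomial (\<lambda>k. if k = j then 1 else 0)"
proof -
  have "monomial (\<lambda>k. if k = j then 1 else 0) = (if j \<in> set [1..<Suc d] then gen j else \<one>\<^bsub>R\<^esub>)"
    unfolding monomial_eq by (rule mon_unit) auto
  then show ?thesis
    using assms letters by metis
qed

text \<open>Prepending a letter multiplies by a monomial, which \<open>monomial_mult\<close>
  absorbs.\<close>

lemma word_monomial:
  "set w \<subseteq> {1..d} \<Longrightarrow> \<exists>c. \<exists>J\<in>E. proj (free_word w) = scal c \<otimes>\<^bsub>R\<^esub> monomial J"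
proof (induction w)
  case Nil
  have "free_word [] = \<one>\<^bsub>free_alg d\<^esub>"
    by (auto simp: free_word_def free_alg_def)
  then show ?case
    using zero_exponent
    by (intro exI[of _ 1] bexI[of _ "\<lambda>k\<in>{1..d}. 0"])
      (simp_all only: monomial_zero scal_1 proj.hom_one r_one one_closed)
next
  case (Cons j w)
  then obtain c J where J: "J \<in> E" "proj (free_word w) = scal c \<otimes>\<^bsub>R\<^esub> monomial J"
    by auto
  have j: "j \<in> {1..d}"
    using Cons by auto
  obtain a where a: "gen j \<otimes>\<^bsub>R\<^esub> monomial J =
      scal a \<otimes>\<^bsub>R\<^esub> monomial (exp_add (\<lambda>k. if k = j then 1 else 0) J)"
    using monomial_mult gen_monomial[OF j] by metis
  have "proj (free_word (j # w)) = gen j \<otimes>\<^bsub>R\<^esub> (scal c \<otimes>\<^bsub>R\<^esub> monomial J)"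
    using Cons free_alg_carrier(2)[OF j] free_alg_carrier(3)[of w d]
    by (simp add: free_word_Cons[where d = d] gen_eq J)
  also have "\<dots> = scal c \<otimes>\<^bsub>R\<^esub> (gen j \<otimes>\<^bsub>R\<^esub> monomial J)"
    using gen_closed[OF j] by (simp add: scal_comm flip: m_assoc)
  also have "\<dots> = scal (c * a) \<otimes>\<^bsub>R\<^esub> monomial (exp_add (\<lambda>k. if k = j then 1 else 0) J)"
    by (simp add: a scal_mult m_assoc)
  finally show ?case
    using exp_add_closed by blast
qed

section \<open>Linear combinations of monomials\<close>

lemma lincomb_closed [simp]: "clif_lincomb m d u \<in> carrier R"
  unfolding clif_lincomb_def by (intro finsum_closed) auto

lemma lincomb_add:
  "clif_lincomb m d (\<lambda>J. u J + v J) = clif_lincomb m d u \<oplus>\<^bsub>R\<^esub> clif_lincomb m d v"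
proof -
  have "clif_lincomb m d (\<lambda>J. u J + v J) =
      (\<Oplus>\<^bsub>R\<^esub>J\<in>E. scal (u J) \<otimes>\<^bsub>R\<^esub> monomial J \<oplus>\<^bsub>R\<^esub> scal (v J) \<otimes>\<^bsub>R\<^esub> monomial J)"
    unfolding clif_lincomb_def by (rule finsum_cong') (simp_all add: scal_add l_distr)
  also have "\<dots> = clif_lincomb m d u \<oplus>\<^bsub>R\<^esub> clif_lincomb m d v"
    unfolding clif_lincomb_def by (rule finsum_addf) simp_all
  finally show ?thesis .
qed

lemma lincomb_single:
  assumes "J \<in> E"
  shows "clif_lincomb m d (\<lambda>K. if K = J then c else 0) = scal c \<otimes>\<^bsub>R\<^esub> monomial J"
proof -
  have "clif_lincomb m d (\<lambda>K. if K = J then c else 0) =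
      (\<Oplus>\<^bsub>R\<^esub>K\<in>E. if J = K then scal c \<otimes>\<^bsub>R\<^esub> monomial K else \<zero>\<^bsub>R\<^esub>)"
    unfolding clif_lincomb_def by (rule finsum_cong') (simp_all add: scal_0)
  also have "\<dots> = scal c \<otimes>\<^bsub>R\<^esub> monomial J"
    using assms finite_exponents by (intro finsum_singleton) simp_all
  finally show ?thesis .
qed

text \<open>Induction on the support of a representative in the free algebra. Only spanning is shown
  here; uniqueness of the grade 0 coefficient comes later from the trace.\<close>

lemma lincomb_exists:
  assumes "x \<in> carrier R"
  shows "\<exists>u. x = clif_lincomb m d u"
proof -
  have "\<exists>u. proj f = clif_lincomb m d u" if "finite S" "{w. f w \<noteq> 0} = S" "f \<in> carrier (free_alg d)"
    for f S
    using that
  proof (induction S arbitrary: f rule: finite_induct)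
    case empty
    then have "f = \<zero>\<^bsub>free_alg d\<^esub>"
      by (auto simp: free_alg_def)
    moreover have "clif_lincomb m d (\<lambda>J. 0) = \<zero>\<^bsub>R\<^esub>"
      unfolding clif_lincomb_def by (simp add: scal_0)
    ultimately show ?case
      using proj.hom_zero by metis
  next
    case (insert w S)
    \<comment> \<open>\<open>?h\<close> is the term of f at the word w and \<open>?g\<close> is the
      rest, with smaller support.\<close>
    let ?g = "f(w := 0)" and ?h = "free_const (f w) \<otimes>\<^bsub>free_alg d\<^esub> free_word w"
    have w: "set w \<subseteq> {1..d}"
      using insert by (auto simp: free_alg_def)
    have S: "{v. ?g v \<noteq> 0} = S"
      using insert by auto
    then have g: "?g \<in> carrier (free_alg d)"
      using insert by (auto simp: free_alg_def)
    obtain u where u: "proj ?g = clif_lincomb m d u"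
      using insert.IH[OF S g] by blast
    obtain c J where J: "J \<in> E" "proj (free_word w) = scal c \<otimes>\<^bsub>R\<^esub> monomial J"
      using word_monomial[OF w] by auto
    have "f = ?h \<oplus>\<^bsub>free_alg d\<^esub> ?g"
      unfolding free_alg_const by (auto simp: free_alg_def free_word_def)
    moreover have "proj (?h \<oplus>\<^bsub>free_alg d\<^esub> ?g) = proj ?h \<oplus>\<^bsub>R\<^esub> proj ?g"
      using g free_alg_carrier(3)[OF w] by (simp add: free_alg_carrier)
    moreover have "proj ?h = scal (f w * c) \<otimes>\<^bsub>R\<^esub> monomial J"
      using free_alg_carrier(3)[OF w] by (simp add: free_alg_carrier J m_assoc scal_mult flip: scal_eq)
    ultimately have "proj f = clif_lincomb m d (\<lambda>K. (if K = J then f w * c else 0) + u K)"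
      by (simp only: lincomb_add lincomb_single[OF J(1)] u)
    then show ?case
      by (rule exI[of "\<lambda>u. proj f = clif_lincomb m d u"])
  qed
  moreover obtain f where "f \<in> carrier (free_alg d)" "x = proj f"
    using assms by (auto simp: carrier_eq)
  moreover have "finite {w. f w \<noteq> 0}"
    using calculation by (simp add: free_alg_def)
  ultimately show ?thesis
    by metis
qed

end

section \<open>The matrix trace and the projection onto grade 0\<close>

locale clifford_rep = clifford +
  fixes \<gamma> :: "clif \<Rightarrow> complex mat"
  assumes rep: "clif_min_rep m d \<gamma>"
begin

abbreviation N where "N \<equiv> clif_N m d"

text \<open>\<open>n\<close> is the size of the diagonal blocks, of which there is a single one if \<open>d\<close> is even, and
  \<open>I\<close> below is the set of positions inside the blocks.\<close>

definition n :: nat where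
  "n = m ^ (d div 2)"

lemma n_pos: "n > 0" and N_pos: "N > 0"
  using m_ge_2 by (simp_all add: n_def clif_N_def)

lemma N_n: "N * n = m ^ d"
proof -
  have "(d + 1) div 2 + d div 2 = d"
    by presburger
  then show ?thesis
    by (simp only: clif_N_def n_def flip: power_add)
qed

text \<open>Makes both parities of d uniform: for even d, N = n and every index below N has block
  number 0, so the condition is vacuous; for odd d there are m blocks of size n.\<close>

lemma rep_carrier: "clif_rep_carrier m d = {X \<in> carrier_mat N N.
    \<forall>i < N. \<forall>j < N. i div n \<noteq> j div n \<longrightarrow> X $$ (i, j) = 0}"
proof (cases "even d")
  case True
  then have "N = n"
    by (auto simp: clif_N_def n_def elim: evenE)
  then show ?thesis
    using True by (auto simp: clif_rep_carrier_def n_def)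
next
  case False
  then have "N = m * n" "(d - 1) div 2 = d div 2"
    by (auto simp: clif_N_def n_def elim!: oddE)
  then show ?thesis
    using False diag_block_mat_carrier[OF n_pos, of m] by (simp add: clif_rep_carrier_def n_def)
qed

section \<open>Calculation rules for the representation\<close>

lemma rep_hom: "\<gamma> \<in> Ring.ring_hom R ((ring_mat TYPE(complex) N ())\<lparr>carrier := clif_rep_carrier m d\<rparr>)"
  and rep_bij: "bij_betw \<gamma> (carrier R) (clif_rep_carrier m d)"
  and rep_scal: "\<gamma> (scal c) = c \<cdot>\<^sub>m 1\<^sub>m N"
  using rep by (simp_all add: clif_min_rep_def ring_iso_def)

lemma rep_mult: "x \<in> carrier R \<Longrightarrow> y \<in> carrier R \<Longrightarrow> \<gamma> (x \<otimes>\<^bsub>R\<^esub> y) = \<gamma> x * \<gamma> y"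
  using ring_hom_mult[OF rep_hom] by (simp add: ring_mat_def)

lemma rep_add: "x \<in> carrier R \<Longrightarrow> y \<in> carrier R \<Longrightarrow> \<gamma> (x \<oplus>\<^bsub>R\<^esub> y) = \<gamma> x + \<gamma> y"
  using ring_hom_add[OF rep_hom] by (simp add: ring_mat_def)

lemma rep_inj: "x \<in> carrier R \<Longrightarrow> y \<in> carrier R \<Longrightarrow> \<gamma> x = \<gamma> y \<Longrightarrow> x = y"
  using bij_betw_imp_inj_on[OF rep_bij] by (rule inj_onD)

lemma rep_surj: "X \<in> clif_rep_carrier m d \<Longrightarrow> \<exists>x\<in>carrier R. \<gamma> x = X"
  unfolding bij_betw_imp_surj_on[OF rep_bij, symmetric] by blast

lemma rep_mat [simp]: "x \<in> carrier R \<Longrightarrow> \<gamma> x \<in> carrier_mat N N"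
  using bij_betwE[OF rep_bij] by (simp add: rep_carrier)

lemma rep_dim [simp]: "x \<in> carrier R \<Longrightarrow> dim_row (\<gamma> x) = N" "x \<in> carrier R \<Longrightarrow> dim_col (\<gamma> x) = N"
  using carrier_matD[OF rep_mat] by blast+

lemma rep_zero: "\<gamma> \<zero>\<^bsub>R\<^esub> = 0\<^sub>m N N"
  unfolding scal_0[symmetric] rep_scal by (rule eq_matI) auto

lemma rep_one: "\<gamma> \<one>\<^bsub>R\<^esub> = 1\<^sub>m N"
  unfolding scal_1[symmetric] rep_scal by (rule eq_matI) auto

text \<open>Follows from additivity applied to x = (x - y) + y.\<close>

lemma rep_minus:
  assumes x: "x \<in> carrier R" and y: "y \<in> carrier R"
  shows "\<gamma> (x \<ominus>\<^bsub>R\<^esub> y) = \<gamma> x - \<gamma> y"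
proof -
  have "x = (x \<ominus>\<^bsub>R\<^esub> y) \<oplus>\<^bsub>R\<^esub> y"
    using x y by (simp add: a_minus_def a_assoc l_neg)
  then have eq: "\<gamma> x = \<gamma> (x \<ominus>\<^bsub>R\<^esub> y) + \<gamma> y"
    using x y rep_add by (metis minus_closed)
  have "\<gamma> (x \<ominus>\<^bsub>R\<^esub> y) \<in> carrier_mat N N"
    using x y by simp
  then show ?thesis
    using rep_mat[OF y] unfolding eq by (intro eq_matI) auto
qed

lemma rep_scal_mult:
  assumes "x \<in> carrier R"
  shows "\<gamma> (scal c \<otimes>\<^bsub>R\<^esub> x) = c \<cdot>\<^sub>m \<gamma> x"
  unfolding rep_mult[OF scal_closed assms] rep_scal
  using assms by (simp add: mult_smult_assoc_mat[of _ N N _ N])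

text \<open>Passing to entries replaces the ring sum by a sum of complex numbers.\<close>

lemma rep_lincomb:
  assumes "i < N" "j < N"
  shows "\<gamma> (clif_lincomb m d u) $$ (i, j) = (\<Sum>J\<in>E. u J * \<gamma> (monomial J) $$ (i, j))"
proof -
  have "\<gamma> (\<Oplus>\<^bsub>R\<^esub>J\<in>A. f J) $$ (i, j) = (\<Sum>J\<in>A. \<gamma> (f J) $$ (i, j))"
    if "finite A" "f \<in> A \<rightarrow> carrier R" for f and A :: "(nat \<Rightarrow> nat) set"
    using that
  proof (induction A rule: finite_induct)
    case empty
    then show ?case
      using assms by (simp add: rep_zero)
  next
    case (insert a A)
    have cl: "f a \<in> carrier R" "finsum R f A \<in> carrier R" "f \<in> A \<rightarrow> carrier R"
      using insert by (auto intro: finsum_closed)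
    then have "finsum R f (insert a A) = f a \<oplus>\<^bsub>R\<^esub> finsum R f A"
      using insert by (intro finsum_insert)
    then have "\<gamma> (finsum R f (insert a A)) = \<gamma> (f a) + \<gamma> (finsum R f A)"
      using cl by (simp only: rep_add)
    moreover have "\<gamma> (finsum R f A) \<in> carrier_mat N N"
      using cl by simp
    ultimately show ?case
      using assms insert.IH[OF cl(3)] insert.hyps by simp
  qed
  from this[OF finite_exponents, of "\<lambda>J. scal (u J) \<otimes>\<^bsub>R\<^esub> monomial J"]
  have "\<gamma> (clif_lincomb m d u) $$ (i, j) = (\<Sum>J\<in>E. (u J \<cdot>\<^sub>m \<gamma> (monomial J)) $$ (i, j))"
    by (simp add: clif_lincomb_def rep_scal_mult)
  also have "\<dots> = (\<Sum>J\<in>E. u J * \<gamma> (monomial J) $$ (i, j))"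
    using assms by simp
  finally show ?thesis .
qed

section \<open>Block positions and the trace of a nontrivial monomial\<close>

definition I :: "(nat \<times> nat) set" where
  "I = Sigma {..<N} (\<lambda>i. {j. j < N \<and> i div n = j div n})"

lemma block_card:
  assumes "i < N"
  shows "card {j. j < N \<and> i div n = j div n} = n"
proof -
  \<comment> \<open>Blocks fill N exactly, so the block containing i is a full interval of n
    indices.\<close>
  have "n dvd N"
    unfolding clif_N_def n_def by (rule le_imp_power_dvd) simp
  then obtain b where b: "N = b * n"
    by (auto simp: dvd_def mult.commute)
  have "i div n < b"
    using assms b n_pos by (simp add: less_mult_imp_div_less)
  then have le: "Suc (i div n) * n \<le> N"
    unfolding b by (intro mult_le_mono1) simp
  have iff: "i div n = j div n \<longleftrightarrow> i div n * n \<le> j \<and> j < Suc (i div n) * n" for j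
    using n_pos div_nat_eqI[of n "i div n" j] dividend_less_div_times[of n j]
      div_times_less_eq_dividend[of j n]
    by (auto simp: mult.commute)
  have "{j. j < N \<and> i div n = j div n} = {i div n * n..<Suc (i div n) * n}"
    unfolding iff using le by (auto simp del: mult_Suc)
  then show ?thesis
    by simp
qed

lemma finite_I: "finite I"
  by (simp add: I_def)

text \<open>Agrees with \<open>card_exponents\<close>: this count makes the change of coordinates in
  \<open>trace_monomial\<close> square.\<close>

lemma card_I: "card I = m ^ d"
  unfolding I_def by (simp add: card_SigmaI block_card N_n)

lemma trace_monomial:
  assumes J: "J \<in> E" and nz: "J \<noteq> (\<lambda>k\<in>{1..d}. 0)"
  shows "(\<Sum>i<N. \<gamma> (monomial J) $$ (i, i)) = 0"
proof -
  let ?X = "\<gamma> (monomial J)"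
  \<comment> \<open>Matrix units inside the blocks lie in the image of \<open>\<gamma>\<close>, so
    they expand in monomials; \<open>q a\<close> holds the coefficients for position a.\<close>
  have "\<exists>u. \<gamma> (clif_lincomb m d u) = mat N N (\<lambda>ij. if ij = a then 1 else 0)" if "a \<in> I" for a
  proof -
    have "mat N N (\<lambda>ij. if ij = a then 1 else 0) \<in> clif_rep_carrier m d"
      using that by (auto simp: rep_carrier I_def)
    then show ?thesis
      using rep_surj lincomb_exists by metis
  qed
  then obtain q where q: "\<And>a. a \<in> I \<Longrightarrow>
      \<gamma> (clif_lincomb m d (q a)) = mat N N (\<lambda>ij. if ij = a then 1 else 0)"
    by metis
  have I_lt: "fst a < N" "snd a < N" if "a \<in> I" for a
    using that by (auto simp: I_def)
  define p where "p a K = \<gamma> (monomial K) $$ a" for a K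
  \<comment> \<open>The entry (i, j) may lie outside the blocks; \<open>diag\<close> needs this when
    its row index runs over all of 0, ..., N-1.\<close>
  have unit: "(\<Sum>K\<in>E. p (i, j) K * q a K) = (if (i, j) = a then 1 else 0)"
    if "a \<in> I" "i < N" "j < N" for a i j
    using q[OF that(1)] rep_lincomb[OF that(2,3), of "q a"] that
    by (simp add: p_def mult.commute)
  have pq: "(\<Sum>K\<in>E. p a K * q b K) = (if a = b then 1 else 0)" if "a \<in> I" "b \<in> I" for a b
    using unit[OF that(2) I_lt[OF that(1)]] by simp
  \<comment> \<open>The coordinate arrays \<open>p\<close> and \<open>q\<close> are square, so they
    are inverse in the other order too.\<close>
  have qp: "(\<Sum>a\<in>I. q a K * p a L) = (if K = L then 1 else 0)" if "K \<in> E" "L \<in> E" for K L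
    using sum_mult_delta_commute[where p = p and q = "\<lambda>K a. q a K", OF finite_I finite_exponents _ pq that]
    by (simp add: card_I card_exponents)
  obtain c where c: "\<And>K. monomial J \<otimes>\<^bsub>R\<^esub> monomial K = scal (c K) \<otimes>\<^bsub>R\<^esub> monomial (exp_add J K)"
    using monomial_mult by metis
  \<comment> \<open>The diagonal entry of X at i is the (i, j) entry of X times the matrix unit at
    (i, j), which is then expanded in monomials.\<close>
  have diag: "?X $$ (i, i) = (\<Sum>K\<in>E. c K * (q (i, j) K * p (i, j) (exp_add J K)))" if "(i, j) \<in> I" for i j
  proof -
    have ij: "i < N" "j < N"
      using that by (auto simp: I_def)
    have "(\<Sum>K\<in>E. c K * (q (i, j) K * p (i, j) (exp_add J K))) =
        (\<Sum>K\<in>E. q (i, j) K * (?X * \<gamma> (monomial K)) $$ (i, j))"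
    proof (rule sum.cong)
      fix K
      have "?X * \<gamma> (monomial K) = c K \<cdot>\<^sub>m \<gamma> (monomial (exp_add J K))"
        by (simp add: c rep_scal_mult flip: rep_mult)
      then show "c K * (q (i, j) K * p (i, j) (exp_add J K)) =
          q (i, j) K * (?X * \<gamma> (monomial K)) $$ (i, j)"
        using ij by (simp add: p_def)
    qed simp
    also have "\<dots> = (\<Sum>K\<in>E. \<Sum>l<N. ?X $$ (i, l) * (p (l, j) K * q (i, j) K))"
    proof (rule sum.cong)
      fix K
      show "q (i, j) K * (?X * \<gamma> (monomial K)) $$ (i, j) =
          (\<Sum>l<N. ?X $$ (i, l) * (p (l, j) K * q (i, j) K))"
        using ij by (simp add: scalar_prod_def p_def lessThan_atLeast0 sum_distrib_left ac_simps)
    qed simp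
    also have "\<dots> = (\<Sum>l<N. ?X $$ (i, l) * (\<Sum>K\<in>E. p (l, j) K * q (i, j) K))"
      by (subst sum.swap) (simp add: sum_distrib_left)
    also have "\<dots> = (\<Sum>l<N. if l = i then ?X $$ (i, l) else 0)"
      using ij by (intro sum.cong) (auto simp: unit[OF that])
    also have "\<dots> = ?X $$ (i, i)"
      using ij by simp
    finally show ?thesis ..
  qed
  \<comment> \<open>Each i is paired with the n column indices of its block, so the trace of left
    multiplication by X is n times that of X.\<close>
  have "of_nat n * (\<Sum>i<N. ?X $$ (i, i)) = (\<Sum>(i, j)\<in>I. ?X $$ (i, i))"
    unfolding I_def by (subst sum.Sigma[symmetric]) (simp_all add: block_card sum_distrib_left)
  also have "\<dots> = (\<Sum>a\<in>I. \<Sum>K\<in>E. c K * (q a K * p a (exp_add J K)))"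
    by (rule sum.cong) (auto simp: diag)
  also have "\<dots> = (\<Sum>K\<in>E. c K * (\<Sum>a\<in>I. q a K * p a (exp_add J K)))"
    by (subst sum.swap) (simp add: sum_distrib_left)
  also have "\<dots> = 0"
  \<comment> \<open>By \<open>qp\<close> each inner sum is a Kronecker delta off the diagonal, since
    J moves every K.\<close>
  proof (intro sum.neutral ballI)
    fix K assume K: "K \<in> E"
    then have "K \<noteq> exp_add J K"
      using exp_add_eq[OF J] nz by metis
    then show "c K * (\<Sum>a\<in>I. q a K * p a (exp_add J K)) = 0"
      using K by (simp add: qp exp_add_closed)
  qed
  finally show ?thesis
    using n_pos by simp
qed

text \<open>By linearity only the identity monomial, of trace N, contributes. As N is nonzero, this
  also fixes the coefficient uniquely and makes the definite description in
  \<open>clif_grade0\<close> meaningful.\<close>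

lemma grade0_eq_trace:
  assumes "x \<in> carrier R"
  shows "of_nat N * clif_grade0 m d x = (\<Sum>i<N. \<gamma> x $$ (i, i))"
proof -
  let ?o = "\<lambda>k\<in>{1..d}. 0 :: nat"
  have tr: "(\<Sum>i<N. \<gamma> (clif_lincomb m d u) $$ (i, i)) = of_nat N * u ?o" for u
  proof -
    have "(\<Sum>i<N. \<gamma> (clif_lincomb m d u) $$ (i, i)) =
        (\<Sum>J\<in>E. u J * (\<Sum>i<N. \<gamma> (monomial J) $$ (i, i)))"
      by (simp add: rep_lincomb sum_distrib_left) (rule sum.swap)
    also have "\<dots> = (\<Sum>J\<in>E. if J = ?o then of_nat N * u ?o else 0)"
    proof (rule sum.cong)
      fix J assume "J \<in> E"
      then show "u J * (\<Sum>i<N. \<gamma> (monomial J) $$ (i, i)) = (if J = ?o then of_nat N * u ?o else 0)"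
        using trace_monomial[of J] by (cases "J = ?o") (simp_all only: monomial_zero rep_one, simp_all)
    qed simp
    also have "\<dots> = of_nat N * u ?o"
      using zero_exponent finite_exponents by simp
    finally show ?thesis .
  qed
  obtain u where u: "x = clif_lincomb m d u"
    using lincomb_exists[OF assms] by blast
  have "clif_grade0 m d x = u ?o"
    unfolding clif_grade0_def
  proof (rule the_equality)
    show "\<exists>v. x = clif_lincomb m d v \<and> u ?o = v ?o"
      using u by blast
  next
    fix c assume "\<exists>v. x = clif_lincomb m d v \<and> c = v ?o"
    then show "c = u ?o"
      using tr u N_pos by (metis mult_cancel_left of_nat_eq_0_iff less_irrefl)
  qed
  then show ?thesis
    using tr u by simp
qed

lemma clif_U_closed: "x \<in> carrier R \<Longrightarrow> clif_U m d x k \<in> carrier R"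
proof (induction k)
  case (Suc k)
  then show ?case
    by (cases k) (simp_all del: clif_C.simps)
qed simp

end

section \<open>The inverse formula, transported through the representation\<close>

theorem corollary7p6:
  fixes m d :: nat and \<gamma> :: "clif \<Rightarrow> complex mat" and U :: clif
  assumes "m \<ge> 2" and "d \<ge> 1"
    and "U \<in> carrier (clif_alg m d)"
    and "clif_min_rep m d \<gamma>"
    and "det (\<gamma> U) \<noteq> 0"
  shows "U \<in> Units (clif_alg m d) \<and>
    inv\<^bsub>clif_alg m d\<^esub> U =
      clif_scalar m d ((-1) ^ clif_N m d / det (\<gamma> U)) \<otimes>\<^bsub>clif_alg m d\<^esub>
        (clif_scalar m d (clif_C m d U (clif_N m d - 1))
           \<ominus>\<^bsub>clif_alg m d\<^esub> clif_U m d U (clif_N m d - 1))"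
proof -
  \<comment> \<open>This rule would unfold every coefficient to a grade 0 projection.\<close>
  note [simp del] = clif_C.simps
  interpret clifford_rep m d \<gamma>
    by unfold_locales (rule assms)+
  note U = assms(3)
  note Uk = clif_U_closed[OF U]
  let ?X = "\<gamma> U" and ?c = "clif_C m d U" and ?Y = "\<lambda>k. \<gamma> (clif_U m d U k)"
  let ?V = "scal (?c (N - 1)) \<ominus>\<^bsub>R\<^esub> clif_U m d U (N - 1)" and ?a = "(-1) ^ N / det ?X"
  let ?W = "scal ?a \<otimes>\<^bsub>R\<^esub> ?V"
  have X: "?X \<in> carrier_mat N N" and Y: "\<And>k. ?Y k \<in> carrier_mat N N"
    by (rule rep_mat[OF U], rule rep_mat[OF Uk])
  have V: "?V \<in> carrier R" and W: "?W \<in> carrier R"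
    using Uk by simp_all
  \<comment> \<open>For d at least 1 the exponent of m in N is at least 1.\<close>
  have "m ^ 1 \<le> N"
    unfolding clif_N_def by (rule power_increasing) (use assms(1,2) in linarith)+
  then have N: "N \<ge> 2"
    using assms(1) unfolding power_one_right by linarith
  have FL: "?X * (?Y (N - 1) - ?c (N - 1) \<cdot>\<^sub>m 1\<^sub>m N) = ((-1) ^ Suc N * det ?X) \<cdot>\<^sub>m 1\<^sub>m N"
  proof (rule faddeev_leverrier[OF X N])
    fix k :: nat assume k: "1 \<le> k"
    then obtain l where l: "k = Suc l"
      using Suc_le_D by auto
    show "?Y (Suc k) = ?X * (?Y k - ?c k \<cdot>\<^sub>m 1\<^sub>m N)"
      unfolding l clif_U.simps using U Uk
      by (simp only: rep_mult rep_minus rep_scal scal_closed minus_closed)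
    show "?c k = (\<Sum>i<N. ?Y k $$ (i, i)) / of_nat k"
      unfolding grade0_eq_trace[OF Uk, symmetric] clif_C.simps[of m d U k] by simp
  qed simp
  \<comment> \<open>\<open>?V\<close> has the opposite order of subtraction from \<open>FL\<close>;
    this minus sign and the (-1)^N in \<open>?a\<close> cancel (-1)^(N+1).\<close>
  have "\<gamma> ?V = (-1) \<cdot>\<^sub>m (?Y (N - 1) - ?c (N - 1) \<cdot>\<^sub>m 1\<^sub>m N)"
    unfolding rep_minus[OF scal_closed Uk] rep_scal using Y[of "N - 1"]
    by (intro eq_matI) auto
  then have "\<gamma> ?W = (- ?a) \<cdot>\<^sub>m (?Y (N - 1) - ?c (N - 1) \<cdot>\<^sub>m 1\<^sub>m N)"
    unfolding rep_scal_mult[OF V] by (simp only: smult_smult mult_minus1_right)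
  moreover have "?Y (N - 1) - ?c (N - 1) \<cdot>\<^sub>m 1\<^sub>m N \<in> carrier_mat N N"
    by (rule minus_carrier_mat) simp
  ultimately have "?X * \<gamma> ?W = (- ?a) \<cdot>\<^sub>m (?X * (?Y (N - 1) - ?c (N - 1) \<cdot>\<^sub>m 1\<^sub>m N))"
    by (simp only: mult_smult_distrib[OF X])
  also have "\<dots> = (- ?a * ((-1) ^ Suc N * det ?X)) \<cdot>\<^sub>m 1\<^sub>m N"
    unfolding FL by (rule smult_smult)
  also have "- ?a * ((-1) ^ Suc N * det ?X) = 1"
    using assms(5) by (simp add: power_mult_distrib[symmetric])
  finally have XW: "?X * \<gamma> ?W = 1\<^sub>m N"
    by (simp only: smult_one)
  \<comment> \<open>Square matrices again: a one-sided inverse is two-sided, and injectivity of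
    \<open>\<gamma>\<close> brings both equations back to \<open>R\<close>.\<close>
  then have WX: "\<gamma> ?W * ?X = 1\<^sub>m N"
    by (rule mat_mult_left_right_inverse[OF X rep_mat[OF W]])
  have UW: "U \<otimes>\<^bsub>R\<^esub> ?W = \<one>\<^bsub>R\<^esub>"
    by (rule rep_inj) (simp_all only: rep_mult U W XW rep_one m_closed one_closed)
  have WU: "?W \<otimes>\<^bsub>R\<^esub> U = \<one>\<^bsub>R\<^esub>"
    by (rule rep_inj) (simp_all only: rep_mult U W WX rep_one m_closed one_closed)
  show ?thesis
    using U W UW WU inv_unique'[OF U W UW WU] unfolding Units_def by blast
qed

end
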